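(* Let $G_1$ and $G_2$ be connected simple graphs on disjoint vertex sets, each 2-line existentially closed and each with at least three vertices. Let $G'=G_1\vee G_2$ be their join, i.e. the graph with vertex set $V(G_1)\cup V(G_2)$ whose edges are the edges of $G_1$, the edges of $G_2$, and all pairs $\{u,v\}$ with $u\in V(G_1)$ and $v\in V(G_2)$. Then $G'$ is 2-line existentially closed.
   Context: Two distinct edges of a graph are adjacent if they share at least one end vertex. A graph with at least two edges is 2-line existentially closed (2-line e.c.) if, for all disjoint sets of edges $A$ and $B$ with $|A\cup B|=2$ (either may be empty), there is an edge $e\notin A\cup B$ that is adjacent to each edge of $A$ and to no edge of $B$. *)

theory Defs
  imports Main
begin

record 'a ugraph =
  verts :: "'a set"
  edges :: "'a set set"

definition simple_graph :: "'a ugraph \<Rightarrow> bool" where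
  "simple_graph G \<longleftrightarrow> (\<forall>e\<in>edges G. e \<subseteq> verts G \<and> card e = 2)"

definition connected_graph :: "'a ugraph \<Rightarrow> bool" where
  "connected_graph G \<longleftrightarrow>
    (\<forall>u\<in>verts G. \<forall>v\<in>verts G. (u, v) \<in> {(x, y). {x, y} \<in> edges G}\<^sup>*)"

(* Graphs may be infinite, whereas card of an infinite set is 0. *)
definition at_least :: "nat \<Rightarrow> 'b set \<Rightarrow> bool" where
  "at_least n S \<longleftrightarrow> infinite S \<or> n \<le> card S"

definition adjacent_edges :: "'a set \<Rightarrow> 'a set \<Rightarrow> bool" where
  "adjacent_edges e f \<longleftrightarrow> e \<noteq> f \<and> e \<inter> f \<noteq> {}"

definition two_line_ec :: "'a ugraph \<Rightarrow> bool" where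
  "two_line_ec G \<longleftrightarrow>
    simple_graph G \<and> at_least 2 (edges G) \<and>
    (\<forall>A B. A \<subseteq> edges G \<longrightarrow> B \<subseteq> edges G \<longrightarrow> A \<inter> B = {} \<longrightarrow> card (A \<union> B) = 2 \<longrightarrow>
      (\<exists>e\<in>edges G - (A \<union> B).
        (\<forall>a\<in>A. adjacent_edges e a) \<and> (\<forall>b\<in>B. \<not> adjacent_edges e b)))"

definition graph_join :: "'a ugraph \<Rightarrow> 'a ugraph \<Rightarrow> 'a ugraph" where
  "graph_join G H =
    \<lparr>verts = verts G \<union> verts H,
     edges = edges G \<union> edges H \<union> {{u, v} | u v. u \<in> verts G \<and> v \<in> verts H}\<rparr>"

end

theory Submission
  imports Defs
begin

text \<open>
  Only pairs of distinct edges of the join have to be examined. Two edges of the same graph have all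
  their witnesses in that graph. In the remaining cases almost every witness is a join edge, chosen
  with the help of a third vertex on one side. There are two exceptions: an edge at a prescribed
  vertex exists by connectedness, and an edge avoiding two prescribed vertices is found by covering
  these vertices with two edges of the same graph and taking an edge adjacent to neither.
\<close>

section \<open>Reformulation in terms of pairs of edges\<close>

text \<open>The four conjuncts are the four ways of distributing \<open>e\<close> and
  \<open>f\<close> over the sets \<open>A\<close> and \<open>B\<close>. Since \<open>g\<close> is
  neither \<open>e\<close> nor \<open>f\<close>, adjacency reduces to a nonempty
  intersection.\<close>

definition ec_pair :: "'a set set \<Rightarrow> 'a set \<Rightarrow> 'a set \<Rightarrow> bool" where
  "ec_pair E e f \<longleftrightarrow>
    (\<exists>g\<in>E - {e, f}. g \<inter> e \<noteq> {} \<and> g \<inter> f \<noteq> {}) \<and>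
    (\<exists>g\<in>E - {e, f}. g \<inter> e \<noteq> {} \<and> g \<inter> f = {}) \<and>
    (\<exists>g\<in>E - {e, f}. g \<inter> e = {} \<and> g \<inter> f \<noteq> {}) \<and>
    (\<exists>g\<in>E - {e, f}. g \<inter> e = {} \<and> g \<inter> f = {})"

text \<open>Reduces each case below to naming four edges, in this order: one meeting both, one
  meeting only \<open>e\<close>, one meeting only \<open>f\<close>, one meeting neither.\<close>

lemma ec_pairI:
  assumes "g1 \<in> E" "g1 \<noteq> e" "g1 \<noteq> f" "g1 \<inter> e \<noteq> {}" "g1 \<inter> f \<noteq> {}"
    and "g2 \<in> E" "g2 \<noteq> e" "g2 \<noteq> f" "g2 \<inter> e \<noteq> {}" "g2 \<inter> f = {}"
    and "g3 \<in> E" "g3 \<noteq> e" "g3 \<noteq> f" "g3 \<inter> e = {}" "g3 \<inter> f \<noteq> {}"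
    and "g4 \<in> E" "g4 \<noteq> e" "g4 \<noteq> f" "g4 \<inter> e = {}" "g4 \<inter> f = {}"
  shows "ec_pair E e f"
  unfolding ec_pair_def
  by (intro conjI; rule bexI[of _ g1] bexI[of _ g2] bexI[of _ g3] bexI[of _ g4];
      simp add: assms; fail)

lemma ec_pair_commute: "ec_pair E e f \<longleftrightarrow> ec_pair E f e"
  by (simp only: ec_pair_def insert_commute conj_ac)

lemma two_line_ec_iff_ec_pair:
  "two_line_ec G \<longleftrightarrow> simple_graph G \<and> at_least 2 (edges G) \<and>
    (\<forall>e\<in>edges G. \<forall>f\<in>edges G. e \<noteq> f \<longrightarrow> ec_pair (edges G) e f)"
  (is "_ \<longleftrightarrow> _ \<and> _ \<and> ?pairs")
proof -
  define P where "P A B \<longleftrightarrow> (\<exists>e\<in>edges G - (A \<union> B).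
        (\<forall>a\<in>A. adjacent_edges e a) \<and> (\<forall>b\<in>B. \<not> adjacent_edges e b))" for A B
  have pair: "ec_pair (edges G) e f \<longleftrightarrow> P {e, f} {} \<and> P {e} {f} \<and> P {f} {e} \<and> P {} {e, f}"
    for e f
    by (simp add: ec_pair_def P_def adjacent_edges_def Bex_def conj_ac cong: conj_cong)
  have "?pairs \<longleftrightarrow> (\<forall>A B. A \<subseteq> edges G \<longrightarrow> B \<subseteq> edges G \<longrightarrow> A \<inter> B = {} \<longrightarrow> card (A \<union> B) = 2 \<longrightarrow> P A B)"
    (is "_ \<longleftrightarrow> ?sets")
  proof
    assume pairs: ?pairs
    show ?sets
    proof (intro allI impI)
      fix A B
      assume sub: "A \<subseteq> edges G" "B \<subseteq> edges G" and disj: "A \<inter> B = {}" and "card (A \<union> B) = 2"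
      then obtain e f where ef: "A \<union> B = {e, f}" "e \<noteq> f"
        unfolding card_2_iff by metis
      have "{e, f} \<subseteq> edges G"
        using sub unfolding ef(1)[symmetric] by (rule Un_least)
      then have pair_ef: "ec_pair (edges G) e f"
        using pairs ef(2) by simp
      \<comment> \<open>\<open>A\<close> is one of the four subsets of \<open>{e, f}\<close> and
        \<open>B\<close> is its complement there, so each possibility is one conjunct of
        \<open>ec_pair\<close>.\<close>
      have "A \<in> Pow {e, f}"
        using ef(1) by (metis PowI Un_upper1)
      then have "A = {} \<or> A = {e} \<or> A = {f} \<or> A = {e, f}"
        by (auto simp: Pow_insert)
      moreover have "B = {e, f} - A"
        unfolding ef(1)[symmetric] using disj by (simp add: Un_Diff Diff_triv Int_commute)
      ultimately show "P A B"
        using pair_ef ef(2) unfolding pair by (elim disjE) (simp_all add: insert_Diff_if)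
    qed
  next
    assume sets: ?sets
    show ?pairs
    proof (intro ballI impI)
      fix e f
      assume "e \<in> edges G" "f \<in> edges G" "e \<noteq> f"
      then show "ec_pair (edges G) e f"
        unfolding pair by (intro conjI sets[rule_format]) simp_all
    qed
  qed
  then show ?thesis
    unfolding two_line_ec_def P_def by simp
qed

section \<open>Vertices and edges in a single graph\<close>

lemma edge_cases:
  assumes "simple_graph G" "e \<in> edges G"
  obtains a b where "e = {a, b}" "a \<noteq> b" "a \<in> verts G" "b \<in> verts G"
proof -
  from assms have sub: "e \<subseteq> verts G" and "card e = 2"
    unfolding simple_graph_def by simp_all
  then obtain a b where "e = {a, b}" "a \<noteq> b"
    by (auto simp: card_2_iff)
  then show thesis
    using that[of a b] sub by simp
qed

lemma at_least_3_obtain: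
  assumes "at_least 3 S"
  obtains z where "z \<in> S" "z \<noteq> x" "z \<noteq> y"
proof -
  have "\<not> S \<subseteq> {x, y}"
  proof
    assume sub: "S \<subseteq> {x, y}"
    then have "finite S"
      using finite_subset by blast
    moreover have "card S \<le> 2"
      \<comment> \<open>Bounding by the length of the list \<open>[x, y]\<close> covers the case
        \<open>x = y\<close> as well.\<close>
      using card_mono[OF _ sub] card_length[of "[x, y]"] by simp
    ultimately show False
      using assms unfolding at_least_def by simp
  qed
  then show thesis
    using that by blast
qed

text \<open>A path from \<open>v\<close> to some other vertex is nonempty, and its first step is an
  edge at \<open>v\<close>.\<close>

lemma connected_incident_edge:
  assumes "connected_graph G" "at_least 3 (verts G)" "v \<in> verts G"
  obtains w where "{v, w} \<in> edges G"
proof -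
  obtain u where u: "u \<in> verts G" "u \<noteq> v"
    using at_least_3_obtain[OF assms(2)] by metis
  then have "(v, u) \<in> {(x, y). {x, y} \<in> edges G}\<^sup>*"
    using assms unfolding connected_graph_def by blast
  then show thesis
    using u(2) that by (cases rule: converse_rtranclE) auto
qed

lemma at_least_2_other:
  assumes "at_least 2 S"
  obtains y where "y \<in> S" "y \<noteq> x"
proof -
  have "\<not> S \<subseteq> {x}"
  proof
    assume sub: "S \<subseteq> {x}"
    then have "finite S" "card S \<le> 1"
      using finite_subset card_mono[OF _ sub] by auto
    then show False
      using assms unfolding at_least_def by simp
  qed
  then show thesis
    using that by blast
qed

text \<open>If two distinct edges together cover \<open>u\<close> and \<open>v\<close>, then an edge
  that meets neither of them avoids both vertices.\<close>

lemma two_line_ec_edge_avoiding: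
  assumes "connected_graph G" "at_least 3 (verts G)" "two_line_ec G"
    and "u \<in> verts G" "v \<in> verts G"
  obtains g where "g \<in> edges G" "u \<notin> g" "v \<notin> g"
proof -
  obtain a b where e: "{u, a} \<in> edges G" and f: "{v, b} \<in> edges G"
    using connected_incident_edge assms by metis
  obtain h where h: "h \<in> edges G" "h \<noteq> {u, a}"
    using at_least_2_other assms(3) unfolding two_line_ec_def by metis
  \<comment> \<open>If the edge chosen at \<open>v\<close> coincides with the one at
    \<open>u\<close>, that single edge already covers both vertices, and any other edge
    \<open>h\<close> completes the pair.\<close>
  obtain f' where f': "f' \<in> edges G" "f' \<noteq> {u, a}" "v \<in> f' \<union> {u, a}"
  proof (cases "{v, b} = {u, a}")
    case True
    then show ?thesis using h that[of h] by blast
  next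
    case False
    then show ?thesis using f that[of "{v, b}"] by blast
  qed
  have "ec_pair (edges G) {u, a} f'"
    using assms(3) e f' unfolding two_line_ec_iff_ec_pair by metis
  then have "\<exists>g\<in>edges G - {{u, a}, f'}. g \<inter> {u, a} = {} \<and> g \<inter> f' = {}"
    unfolding ec_pair_def by (elim conjE)
  then obtain g where "g \<in> edges G" "g \<inter> {u, a} = {}" "g \<inter> f' = {}"
    by (elim bexE conjE DiffE)
  then show thesis
    using f'(3) that[of g] by (auto simp: disjoint_iff)
qed

section \<open>The join and its edges\<close>

lemma graph_join_commute: "graph_join G H = graph_join H G"
proof -
  have "{{u, v} | u v. u \<in> verts G \<and> v \<in> verts H} = {{u, v} | u v. u \<in> verts H \<and> v \<in> verts G}"
    by (metis (no_types, lifting) doubleton_eq_iff)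
  then show ?thesis
    unfolding graph_join_def by (simp add: Un_commute)
qed

locale ec_join =
  fixes G H :: "'a ugraph"
  assumes conn: "connected_graph G" "connected_graph H"
    and disj: "verts G \<inter> verts H = {}"
    and ec: "two_line_ec G" "two_line_ec H"
    and verts3: "at_least 3 (verts G)" "at_least 3 (verts H)"
begin

abbreviation "E \<equiv> edges (graph_join G H)"

lemma simple: "simple_graph G" "simple_graph H"
  using ec unfolding two_line_ec_def by auto

lemma left_edge: "e \<in> edges G \<Longrightarrow> e \<in> E"
  and right_edge: "e \<in> edges H \<Longrightarrow> e \<in> E"
  and cross_edge: "u \<in> verts G \<Longrightarrow> v \<in> verts H \<Longrightarrow> {u, v} \<in> E"
  unfolding graph_join_def by auto

text \<open>Both orientations are stated so that the simplifier can decide every equation between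
  vertices of different sides.\<close>

lemma cross_ne:
  assumes "u \<in> verts G" "v \<in> verts H"
  shows "u \<noteq> v" "v \<noteq> u"
  using assms disj by blast+

lemma right_sub: "e \<in> edges H \<Longrightarrow> e \<subseteq> verts H"
  using simple(2) unfolding simple_graph_def by auto

section \<open>Pairs of edges of the join, by type\<close>

text \<open>The conditions on a witness involve only its relation to \<open>e\<close> and
  \<open>f\<close>, so witnesses in \<open>G\<close> remain witnesses in the larger edge
  set.\<close>

lemma ec_pair_left_left:
  assumes "e \<in> edges G" "f \<in> edges G" "e \<noteq> f"
  shows "ec_pair E e f"
proof -
  have pair: "ec_pair (edges G) e f"
    using ec(1) assms unfolding two_line_ec_iff_ec_pair by simp
  have lift: "\<exists>g\<in>E - {e, f}. Q g" if "\<exists>g\<in>edges G - {e, f}. Q g" for Q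
    using that left_edge by auto
  then show ?thesis
    using pair unfolding ec_pair_def by (elim conjE) (intro conjI; rule lift)
qed

text \<open>A join edge may choose its end in \<open>G\<close> on or off \<open>e\<close> and,
  independently, its end in \<open>H\<close> on or off \<open>f\<close>. This gives all four
  witnesses.\<close>

lemma ec_pair_left_right:
  assumes "e \<in> edges G" "f \<in> edges H"
  shows "ec_pair E e f"
proof -
  obtain a b where e: "e = {a, b}" "a \<noteq> b" "a \<in> verts G" "b \<in> verts G"
    using edge_cases[OF simple(1) assms(1)] .
  obtain c d where f: "f = {c, d}" "c \<noteq> d" "c \<in> verts H" "d \<in> verts H"
    using edge_cases[OF simple(2) assms(2)] .
  obtain x where x: "x \<in> verts G" "x \<noteq> a" "x \<noteq> b"
    using at_least_3_obtain[OF verts3(1)] .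
  obtain y where y: "y \<in> verts H" "y \<noteq> c" "y \<noteq> d"
    using at_least_3_obtain[OF verts3(2)] .
  show ?thesis
    by (rule ec_pairI[of "{a, c}" _ _ _ "{a, y}" "{x, c}" "{x, y}"])
      (use e f x y in \<open>simp_all add: doubleton_eq_iff cross_ne cross_edge\<close>)
qed

lemma ec_pair_left_cross:
  assumes "e \<in> edges G" "x \<in> verts G" "y \<in> verts H"
  shows "ec_pair E e {x, y}"
proof -
  \<comment> \<open>At least one end of \<open>e\<close> differs from \<open>x\<close>; it is named
    \<open>a\<close>. The other end \<open>b\<close> may equal \<open>x\<close>.\<close>
  obtain a b where e: "e = {a, b}" "a \<noteq> x" and ab: "a \<in> verts G" "b \<in> verts G"
    using edge_cases[OF simple(1) assms(1)] by (metis insert_commute)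
  obtain y' where y': "y' \<in> verts H" "y' \<noteq> y"
    using at_least_3_obtain[OF verts3(2)] by metis
  \<comment> \<open>The two witnesses that must miss \<open>e\<close> are taken inside
    \<open>H\<close>, where they automatically miss \<open>x\<close> too: one passes through
    \<open>y\<close>, the other avoids \<open>y\<close>.\<close>
  obtain w where w: "{y, w} \<in> edges H"
    using connected_incident_edge[OF conn(2) verts3(2) assms(3)] .
  then have wH: "w \<in> verts H"
    using right_sub by blast
  obtain h where h: "h \<in> edges H" "y \<notin> h"
    using two_line_ec_edge_avoiding[OF conn(2) verts3(2) ec(2) assms(3,3)] by metis
  obtain p q where pq: "h = {p, q}" "p \<in> verts H" "q \<in> verts H"
    using edge_cases[OF simple(2) h(1)] by metis
  have pqE: "{p, q} \<in> E" and pqy: "p \<noteq> y" "q \<noteq> y"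
    using h pq(1) right_edge by auto
  show ?thesis
    unfolding e(1)
    by (rule ec_pairI[of "{a, y}" _ _ _ "{a, y'}" "{y, w}" "{p, q}"])
      (use e(2) ab y' wH pq(2,3) pqE pqy right_edge[OF w] assms(2,3)
        in \<open>simp_all add: doubleton_eq_iff cross_ne cross_edge\<close>)
qed

text \<open>As \<open>x\<close> and \<open>x'\<close> differ, joining either of them to a vertex
  \<open>w\<close> off both edges meets exactly one edge. An edge of \<open>G\<close> avoiding
  \<open>x\<close> and \<open>x'\<close> meets neither.\<close>

lemma ec_pair_cross_cross_aux:
  assumes "x \<in> verts G" "y \<in> verts H" "x' \<in> verts G" "y' \<in> verts H" "x \<noteq> x'"
  shows "ec_pair E {x, y} {x', y'}"
proof -
  obtain w where w: "w \<in> verts H" "w \<noteq> y" "w \<noteq> y'"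
    using at_least_3_obtain[OF verts3(2)] .
  obtain z where z: "z \<in> verts G" "z \<noteq> x" "z \<noteq> x'"
    using at_least_3_obtain[OF verts3(1)] .
  obtain g where g: "g \<in> edges G" "x \<notin> g" "x' \<notin> g"
    using two_line_ec_edge_avoiding[OF conn(1) verts3(1) ec(1) assms(1,3)] .
  obtain a b where ab: "g = {a, b}" "a \<in> verts G" "b \<in> verts G"
    using edge_cases[OF simple(1) g(1)] by metis
  have abE: "{a, b} \<in> E" and ne: "a \<noteq> x" "b \<noteq> x" "a \<noteq> x'" "b \<noteq> x'"
    using g ab(1) left_edge by auto
  \<comment> \<open>The natural choice \<open>{x, y'}\<close> is the first edge itself when
    \<open>y = y'\<close>; in that case the common end is joined to a third vertex \<open>z\<close>
    instead.\<close>
  obtain p where p: "p \<in> E" "p \<noteq> {x, y}" "p \<noteq> {x', y'}" "p \<inter> {x, y} \<noteq> {}" "p \<inter> {x', y'} \<noteq> {}"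
  proof (cases "y = y'")
    case True
    show ?thesis
      by (rule that[of "{z, y}"])
        (use True z assms in \<open>simp_all add: doubleton_eq_iff cross_ne cross_edge\<close>)
  next
    case False
    show ?thesis
      by (rule that[of "{x, y'}"])
        (use False assms in \<open>simp_all add: doubleton_eq_iff cross_ne cross_edge\<close>)
  qed
  show ?thesis
    by (rule ec_pairI[of p _ _ _ "{x, w}" "{x', w}" "{a, b}"])
      (use p w ab(2,3) abE ne assms in \<open>simp_all add: doubleton_eq_iff cross_ne cross_edge\<close>)
qed

text \<open>Together with \<open>graph_join_commute\<close>, this turns a result about one side into
  its mirror image for the same join.\<close>

lemma swap: "ec_join H G"
  using conn disj ec verts3 by unfold_locales auto

lemma ec_pair_cross_cross:
  assumes "x \<in> verts G" "y \<in> verts H" "x' \<in> verts G" "y' \<in> verts H" "{x, y} \<noteq> {x', y'}"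
  shows "ec_pair E {x, y} {x', y'}"
proof (cases "x = x'")
  case True
  \<comment> \<open>The edges share their end in \<open>G\<close>, so their ends in \<open>H\<close>
    differ and the mirrored auxiliary lemma applies.\<close>
  then have "y \<noteq> y'"
    using assms by blast
  then show ?thesis
    using ec_join.ec_pair_cross_cross_aux[OF swap assms(2,1,4,3)]
    by (simp add: graph_join_commute[of H] insert_commute)
next
  case False
  then show ?thesis
    using ec_pair_cross_cross_aux assms by blast
qed

section \<open>Combining the cases\<close>

lemma edge_join_cases:
  assumes "e \<in> E"
  obtains (left) "e \<in> edges G" | (right) "e \<in> edges H"
  | (cross) x y where "e = {x, y}" "x \<in> verts G" "y \<in> verts H"
  using assms unfolding graph_join_def by auto

lemma ec_pair_left:
  assumes "e \<in> edges G" "f \<in> E" "e \<noteq> f"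
  shows "ec_pair E e f"
  using assms(2)
  by (cases rule: edge_join_cases)
    (use assms ec_pair_left_left ec_pair_left_right ec_pair_left_cross in auto)

lemma ec_pair_right:
  assumes "e \<in> edges H" "f \<in> E" "e \<noteq> f"
  shows "ec_pair E e f"
  using ec_join.ec_pair_left[OF swap, of e f] assms by (simp add: graph_join_commute[of H])

lemma ec_pair_join:
  assumes "e \<in> E" "f \<in> E" "e \<noteq> f"
  shows "ec_pair E e f"
  using assms(1)
proof (cases rule: edge_join_cases)
  case left
  then show ?thesis using ec_pair_left assms by blast
next
  case right
  then show ?thesis using ec_pair_right assms by blast
next
  case e: (cross x y)
  from assms(2) show ?thesis
  proof (cases rule: edge_join_cases)
    case left
    \<comment> \<open>Here only the second edge lies inside one of the graphs; symmetry of
      \<open>ec_pair\<close> lets it take the first place.\<close>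
    then show ?thesis using ec_pair_left assms ec_pair_commute by metis
  next
    case right
    then show ?thesis using ec_pair_right assms ec_pair_commute by metis
  next
    case (cross x' y')
    then show ?thesis using ec_pair_cross_cross e assms(3) by blast
  qed
qed

text \<open>Join edges have two distinct ends because the vertex sets are disjoint.\<close>

lemma simple_join: "simple_graph (graph_join G H)"
  using simple cross_ne unfolding simple_graph_def graph_join_def by (auto simp: card_insert_if)

lemma at_least_2_join: "at_least 2 E"
proof (cases "finite E")
  case True
  have sub: "edges G \<subseteq> E"
    using left_edge by blast
  then have "finite (edges G)"
    using True finite_subset by blast
  then have "2 \<le> card (edges G)"
    using ec(1) unfolding two_line_ec_def at_least_def by blast
  then show ?thesis
    using card_mono[OF True sub] unfolding at_least_def by simp
qed (simp add: at_least_def)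

lemma two_line_ec_join: "two_line_ec (graph_join G H)"
  unfolding two_line_ec_iff_ec_pair
  using simple_join at_least_2_join ec_pair_join by blast

end

theorem theorem8:
  fixes G\<^sub>1 G\<^sub>2 :: "'a ugraph"
  assumes "simple_graph G\<^sub>1" and "simple_graph G\<^sub>2"
    and "connected_graph G\<^sub>1" and "connected_graph G\<^sub>2"
    and "verts G\<^sub>1 \<inter> verts G\<^sub>2 = {}"
    and "two_line_ec G\<^sub>1" and "two_line_ec G\<^sub>2"
    and "at_least 3 (verts G\<^sub>1)" and "at_least 3 (verts G\<^sub>2)"
  shows "two_line_ec (graph_join G\<^sub>1 G\<^sub>2)"
proof -
  interpret ec_join G\<^sub>1 G\<^sub>2
    using assms by unfold_locales
  show ?thesis
    by (rule two_line_ec_join)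
qed

end
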